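(* Let $n\ge2$ and let $\bar\lambda=(\lambda^{(b)})_{b=0}^{n-1}$ be a collection of dominant integral $\mathfrak{sl}_n$-weights. Then the subspace $V_{\bar\lambda}(0)\subset\bigotimes_{b=0}^{n-1}V_{\lambda^{(b)}}$ admits a natural action of the Lie algebra $\mathfrak I_1$ compatible with the embedding $\mathfrak I_1\subset\bigoplus_{b=0}^{n-1}\mathfrak{gl}_n$; i.e. $V_{\bar\lambda}(0)$ is stable under $\mathfrak I_1$, where the $b$-th component acts on the $b$-th tensor factor.
   Context: $V_\mu$ is the irreducible $\mathfrak{sl}_n$-module of dominant integral highest weight $\mu$ over $\mathbb C$, regarded as a $\mathfrak{gl}_n$-module by viewing $\mu$ as a partition with last part $0$; $v_\mu\in V_\mu$ is a lowest weight vector; $E_{i,j}$ are matrix units. $\mathfrak I_1(\varepsilon)$ is the Lie subalgebra of $\bigoplus_{b=0}^{n-1}\mathfrak{gl}_n$ spanned by the tuples $(x_b)_{b=0}^{n-1}$ of the form: (i) $x_b=E_{i,i}$ for all $b$ ($1\le i\le n$); (ii) for $1\le i<j\le n$: $x_b=\varepsilon E_{i,j}$ if $i\le b<j$ and $x_b=E_{i,j}$ otherwise; (iii) for $1\le i<j\le n$: $x_b=E_{j,i}$ if $i\le b<j$ and $x_b=\varepsilon E_{j,i}$ otherwise. Put $\mathfrak I_1=\mathfrak I_1(0)$. Treat $\varepsilon$ as a formal variable and let $V_{\bar\lambda}(\varepsilon)\subset(\bigotimes_b V_{\lambda^{(b)}})[\varepsilon]$ be the $\mathbb C[\varepsilon]$-submodule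 generated from $\bigotimes_b v_{\lambda^{(b)}}$ by the operators of $\mathfrak I_1(\varepsilon)$ (the $b$-th component acting on the $b$-th factor). Then $V_{\bar\lambda}(0)=\{(\varepsilon^{-r}p)|_{\varepsilon=0}: r\ge0,\ p\in V_{\bar\lambda}(\varepsilon)\cap\varepsilon^r(\bigotimes_b V_{\lambda^{(b)}})[\varepsilon]\}$, i.e. the limit as $\varepsilon\to0$ of the subspaces $\mathrm U(\mathfrak I_1(\varepsilon)).\bigotimes_b v_{\lambda^{(b)}}$. *)

theory Defs
  imports
    Complex_Main
    "HOL-Library.FuncSet"
    "HOL-Library.Function_Algebras"
    "HOL-Computational_Algebra.Polynomial"
    "Jordan_Normal_Form.Matrix"
begin

section \<open>Lie algebras of matrices and their modules\<close>

text \<open>Matrix units are indexed from 1, whereas entries of \<^typ>\<open>'a mat\<close> are indexed from 0.\<close>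

definition matrix_unit :: "nat \<Rightarrow> nat \<Rightarrow> nat \<Rightarrow> 'a::{zero,one} mat" where
  "matrix_unit n i j = mat n n (\<lambda>(k, l). if Suc k = i \<and> Suc l = j then 1 else 0)"

definition commutator :: "'a::ring mat \<Rightarrow> 'a mat \<Rightarrow> 'a mat" where
  "commutator x y = x * y - y * x"

text \<open>The set \<open>L\<close> with the operations \<open>plus\<^sub>L\<close>, \<open>scale\<^sub>L\<close> and \<open>br\<close> is closed under these operations and
  acts on the subspace \<open>V\<close> of an ambient complex vector space. The operations are explicit arguments
  because matrices of a fixed size, and tuples of them, are not types of class
  \<^class>\<open>ab_group_add\<close>. That they satisfy the Lie algebra axioms is not part of the predicate: it is
  used only for subsets of \<open>gl_n\<close> and of a direct sum of copies of \<open>gl_n\<close>.\<close>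

definition lie_action ::
  "'g set \<Rightarrow> ('g \<Rightarrow> 'g \<Rightarrow> 'g) \<Rightarrow> (complex \<Rightarrow> 'g \<Rightarrow> 'g) \<Rightarrow> ('g \<Rightarrow> 'g \<Rightarrow> 'g) \<Rightarrow>
   (complex \<Rightarrow> 'v::ab_group_add \<Rightarrow> 'v) \<Rightarrow> 'v set \<Rightarrow> ('g \<Rightarrow> 'v \<Rightarrow> 'v) \<Rightarrow> bool" where
  "lie_action L plus\<^sub>L scale\<^sub>L br scale V act \<longleftrightarrow>
     (\<forall>x\<in>L. \<forall>y\<in>L. plus\<^sub>L x y \<in> L \<and> br x y \<in> L) \<and> (\<forall>c. \<forall>x\<in>L. scale\<^sub>L c x \<in> L) \<and>
     module.subspace scale V \<and>
     (\<forall>x\<in>L. \<forall>v\<in>V. act x v \<in> V) \<and>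
     (\<forall>x\<in>L. \<forall>v\<in>V. \<forall>w\<in>V. act x (v + w) = act x v + act x w) \<and>
     (\<forall>x\<in>L. \<forall>c. \<forall>v\<in>V. act x (scale c v) = scale c (act x v)) \<and>
     (\<forall>x\<in>L. \<forall>y\<in>L. \<forall>v\<in>V. act (plus\<^sub>L x y) v = act x v + act y v) \<and>
     (\<forall>x\<in>L. \<forall>c. \<forall>v\<in>V. act (scale\<^sub>L c x) v = scale c (act x v)) \<and>
     (\<forall>x\<in>L. \<forall>y\<in>L. \<forall>v\<in>V. act (br x y) v = act x (act y v) - act y (act x v))"

definition gl_module ::
  "nat \<Rightarrow> (complex \<Rightarrow> 'v::ab_group_add \<Rightarrow> 'v) \<Rightarrow> 'v set \<Rightarrow> (complex mat \<Rightarrow> 'v \<Rightarrow> 'v) \<Rightarrow> bool" where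
  "gl_module n scale V \<rho> \<longleftrightarrow>
     lie_action (carrier_mat n n) (+) (\<cdot>\<^sub>m) commutator scale V \<rho>"

definition sl_carrier :: "nat \<Rightarrow> complex mat set" where
  "sl_carrier n = {x \<in> carrier_mat n n. (\<Sum>i<n. x $$ (i, i)) = 0}"

definition sl_irreducible ::
  "nat \<Rightarrow> (complex \<Rightarrow> 'v::ab_group_add \<Rightarrow> 'v) \<Rightarrow> 'v set \<Rightarrow> (complex mat \<Rightarrow> 'v \<Rightarrow> 'v) \<Rightarrow> bool" where
  "sl_irreducible n scale V \<rho> \<longleftrightarrow> V \<noteq> {0} \<and>
     (\<forall>W. module.subspace scale W \<and> W \<subseteq> V \<and> (\<forall>x\<in>sl_carrier n. \<forall>w\<in>W. \<rho> x w \<in> W) \<longrightarrow>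
        W = {0} \<or> W = V)"

definition gl_weight_vector ::
  "nat \<Rightarrow> (complex \<Rightarrow> 'v::ab_group_add \<Rightarrow> 'v) \<Rightarrow> 'v set \<Rightarrow> (complex mat \<Rightarrow> 'v \<Rightarrow> 'v) \<Rightarrow>
   (nat \<Rightarrow> complex) \<Rightarrow> 'v \<Rightarrow> bool" where
  "gl_weight_vector n scale V \<rho> \<nu> v \<longleftrightarrow> v \<in> V \<and> v \<noteq> 0 \<and>
     (\<forall>i\<in>{1..n}. \<rho> (matrix_unit n i i) v = scale (\<nu> i) v)"

text \<open>A weight \<open>\<mu>\<close> of \<open>sl_n\<close> is given by its values on the simple coroots
  \<open>E_{i,i} - E_{i+1,i+1}\<close>, \<open>1 \<le> i < n\<close>. The numbers \<open>weight_part n \<mu> i\<close>, \<open>1 \<le> i \<le> n\<close>, are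
  determined by having successive differences \<open>\<mu> i\<close> and last entry \<open>0\<close>.\<close>

definition dominant_integral :: "nat \<Rightarrow> (nat \<Rightarrow> complex) \<Rightarrow> bool" where
  "dominant_integral n \<mu> \<longleftrightarrow> (\<forall>i\<in>{1..<n}. \<mu> i \<in> \<nat>)"

definition weight_part :: "nat \<Rightarrow> (nat \<Rightarrow> complex) \<Rightarrow> nat \<Rightarrow> complex" where
  "weight_part n \<mu> i = (\<Sum>k\<in>{i..<n}. \<mu> k)"

text \<open>\<open>V\<close> with the action \<open>\<rho>\<close> is a model of the irreducible \<open>sl_n\<close>-module of highest weight \<open>\<mu>\<close>,
  extended to \<open>gl_n\<close> so that the highest weight becomes the partition above.\<close>

definition irreducible_highest_weight_module ::
  "nat \<Rightarrow> (complex \<Rightarrow> 'v::ab_group_add \<Rightarrow> 'v) \<Rightarrow> 'v set \<Rightarrow> (complex mat \<Rightarrow> 'v \<Rightarrow> 'v) \<Rightarrow>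
   (nat \<Rightarrow> complex) \<Rightarrow> bool" where
  "irreducible_highest_weight_module n scale V \<rho> \<mu> \<longleftrightarrow>
     gl_module n scale V \<rho> \<and> sl_irreducible n scale V \<rho> \<and>
     (\<exists>u. gl_weight_vector n scale V \<rho> (weight_part n \<mu>) u \<and>
        (\<forall>i j. 1 \<le> i \<and> i < j \<and> j \<le> n \<longrightarrow> \<rho> (matrix_unit n i j) u = 0))"

definition lowest_weight_vector ::
  "nat \<Rightarrow> (complex \<Rightarrow> 'v::ab_group_add \<Rightarrow> 'v) \<Rightarrow> 'v set \<Rightarrow> (complex mat \<Rightarrow> 'v \<Rightarrow> 'v) \<Rightarrow> 'v \<Rightarrow> bool"
  where
  "lowest_weight_vector n scale V \<rho> v \<longleftrightarrow>
     (\<exists>\<nu>. gl_weight_vector n scale V \<rho> \<nu> v) \<and>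
     (\<forall>i j. 1 \<le> i \<and> i < j \<and> j \<le> n \<longrightarrow> \<rho> (matrix_unit n j i) v = 0)"

section \<open>The algebras \<open>\<II>\<^sub>1(\<epsilon>)\<close>\<close>

text \<open>Elements of the direct sum of \<open>n\<close> copies of \<open>gl_n\<close> are extensional functions on \<open>{..<n}\<close>.\<close>

definition tuple_add :: "nat \<Rightarrow> (nat \<Rightarrow> 'a::plus mat) \<Rightarrow> (nat \<Rightarrow> 'a mat) \<Rightarrow> (nat \<Rightarrow> 'a mat)" where
  "tuple_add n x y = (\<lambda>b\<in>{..<n}. x b + y b)"

definition tuple_smult :: "nat \<Rightarrow> 'a::times \<Rightarrow> (nat \<Rightarrow> 'a mat) \<Rightarrow> (nat \<Rightarrow> 'a mat)" where
  "tuple_smult n c x = (\<lambda>b\<in>{..<n}. c \<cdot>\<^sub>m x b)"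

definition tuple_bracket :: "nat \<Rightarrow> (nat \<Rightarrow> 'a::ring mat) \<Rightarrow> (nat \<Rightarrow> 'a mat) \<Rightarrow> (nat \<Rightarrow> 'a mat)" where
  "tuple_bracket n x y = (\<lambda>b\<in>{..<n}. commutator (x b) (y b))"

definition I1_generators :: "nat \<Rightarrow> 'a::comm_ring_1 \<Rightarrow> (nat \<Rightarrow> 'a mat) set" where
  "I1_generators n e =
     {(\<lambda>b\<in>{..<n}. matrix_unit n i i) | i. 1 \<le> i \<and> i \<le> n} \<union>
     {(\<lambda>b\<in>{..<n}. if i \<le> b \<and> b < j then e \<cdot>\<^sub>m matrix_unit n i j else matrix_unit n i j) | i j.
        1 \<le> i \<and> i < j \<and> j \<le> n} \<union>
     {(\<lambda>b\<in>{..<n}. if i \<le> b \<and> b < j then matrix_unit n j i else e \<cdot>\<^sub>m matrix_unit n j i) | i j.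
        1 \<le> i \<and> i < j \<and> j \<le> n}"

text \<open>The span over an arbitrary coefficient ring. Over \<^typ>\<open>complex\<close>, \<open>I1 n 0\<close> is \<open>\<II>\<^sub>1\<close>; over
  \<^typ>\<open>complex poly\<close>, \<open>I1 n [:0, 1:]\<close> is \<open>\<II>\<^sub>1(\<epsilon>)\<close> with \<open>\<epsilon>\<close> a formal variable.\<close>

inductive_set I1 :: "nat \<Rightarrow> 'a::comm_ring_1 \<Rightarrow> (nat \<Rightarrow> 'a mat) set" for n :: nat and e :: 'a where
  zero: "(\<lambda>b\<in>{..<n}. 0\<^sub>m n n) \<in> I1 n e"
| generator: "x \<in> I1_generators n e \<Longrightarrow> x \<in> I1 n e"
| add: "x \<in> I1 n e \<Longrightarrow> y \<in> I1 n e \<Longrightarrow> tuple_add n x y \<in> I1 n e"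
| smult: "x \<in> I1 n e \<Longrightarrow> tuple_smult n c x \<in> I1 n e"

section \<open>Tensor products\<close>

text \<open>A form that is linear in each of its \<open>n\<close> arguments, normalised to vanish outside the product of
  the spaces \<open>V b\<close>, \<open>b < n\<close>.\<close>

definition multilinear_form ::
  "nat \<Rightarrow> (complex \<Rightarrow> 'v::ab_group_add \<Rightarrow> 'v) \<Rightarrow> (nat \<Rightarrow> 'v set) \<Rightarrow> ((nat \<Rightarrow> 'v) \<Rightarrow> complex) \<Rightarrow> bool" where
  "multilinear_form n scale V m \<longleftrightarrow>
     (\<forall>v. v \<notin> Pi\<^sub>E {..<n} V \<longrightarrow> m v = 0) \<and>
     (\<forall>v\<in>Pi\<^sub>E {..<n} V. \<forall>b<n.
        (\<forall>u\<in>V b. \<forall>w\<in>V b. m (v(b := u + w)) = m (v(b := u)) + m (v(b := w))) \<and>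
        (\<forall>c. \<forall>u\<in>V b. m (v(b := scale c u)) = c * m (v(b := u))))"

text \<open>Over a field the elements of a tensor product are separated by the multilinear forms on its
  factors. The tensor product is therefore realised inside the dual of the space of multilinear forms:
  a pure tensor is evaluation at its factors, and the tensor product is the span of the pure tensors.
  Functions on multilinear forms are normalised to vanish at all other functions.\<close>

type_synonym 'v tensor = "((nat \<Rightarrow> 'v) \<Rightarrow> complex) \<Rightarrow> complex"

definition tensor_scale :: "complex \<Rightarrow> 'v tensor \<Rightarrow> 'v tensor" where
  "tensor_scale c t = (\<lambda>m. c * t m)"

definition pure_tensor ::
  "nat \<Rightarrow> (complex \<Rightarrow> 'v::ab_group_add \<Rightarrow> 'v) \<Rightarrow> (nat \<Rightarrow> 'v set) \<Rightarrow> (nat \<Rightarrow> 'v) \<Rightarrow> 'v tensor" where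
  "pure_tensor n scale V v =
     (\<lambda>m. if multilinear_form n scale V m then m (restrict v {..<n}) else 0)"

definition tensor_product ::
  "nat \<Rightarrow> (complex \<Rightarrow> 'v::ab_group_add \<Rightarrow> 'v) \<Rightarrow> (nat \<Rightarrow> 'v set) \<Rightarrow> 'v tensor set" where
  "tensor_product n scale V = module.span tensor_scale (pure_tensor n scale V ` Pi\<^sub>E {..<n} V)"

text \<open>An operator \<open>A\<close> on \<open>V b\<close> acts on the \<open>b\<close>-th factor by transposing the substitution of \<open>A\<close> into
  the \<open>b\<close>-th argument of a multilinear form; see \<open>factor_action_pure_tensor\<close> below.\<close>

definition factor_action ::
  "nat \<Rightarrow> (complex \<Rightarrow> 'v::ab_group_add \<Rightarrow> 'v) \<Rightarrow> (nat \<Rightarrow> 'v set) \<Rightarrow> nat \<Rightarrow> ('v \<Rightarrow> 'v) \<Rightarrow>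
   'v tensor \<Rightarrow> 'v tensor" where
  "factor_action n scale V b A t =
     (\<lambda>m. if multilinear_form n scale V m
          then t (\<lambda>v. if v \<in> Pi\<^sub>E {..<n} V then m (v(b := A (v b))) else 0) else 0)"

definition tensor_action ::
  "nat \<Rightarrow> (complex \<Rightarrow> 'v::ab_group_add \<Rightarrow> 'v) \<Rightarrow> (nat \<Rightarrow> 'v set) \<Rightarrow> (nat \<Rightarrow> complex mat \<Rightarrow> 'v \<Rightarrow> 'v) \<Rightarrow>
   (nat \<Rightarrow> complex mat) \<Rightarrow> 'v tensor \<Rightarrow> 'v tensor" where
  "tensor_action n scale V \<rho> x t = (\<Sum>b<n. factor_action n scale V b (\<rho> b (x b)) t)"

section \<open>Polynomials in \<open>\<epsilon>\<close> with tensor coefficients\<close>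

definition tensor_polys ::
  "nat \<Rightarrow> (complex \<Rightarrow> 'v::ab_group_add \<Rightarrow> 'v) \<Rightarrow> (nat \<Rightarrow> 'v set) \<Rightarrow> 'v tensor poly set" where
  "tensor_polys n scale V = {p. \<forall>k. coeff p k \<in> tensor_product n scale V}"

text \<open>Multiplication by a polynomial, by Horner's rule; see \<open>coeff_poly_scale\<close> below. (The pointwise
  product of the type \<^typ>\<open>'v tensor\<close> plays no role.)\<close>

definition poly_scale :: "complex poly \<Rightarrow> 'v tensor poly \<Rightarrow> 'v tensor poly" where
  "poly_scale f p = fold_coeffs (\<lambda>a q. map_poly (tensor_scale a) p + pCons 0 q) f 0"

text \<open>The \<open>\<complex>[\<epsilon>]\<close>-linear extension of the action of the direct sum of \<open>n\<close> copies of \<open>gl_n\<close>,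
  written out in the basis of matrix units.\<close>

definition poly_action ::
  "nat \<Rightarrow> (complex \<Rightarrow> 'v::ab_group_add \<Rightarrow> 'v) \<Rightarrow> (nat \<Rightarrow> 'v set) \<Rightarrow> (nat \<Rightarrow> complex mat \<Rightarrow> 'v \<Rightarrow> 'v) \<Rightarrow>
   (nat \<Rightarrow> complex poly mat) \<Rightarrow> 'v tensor poly \<Rightarrow> 'v tensor poly" where
  "poly_action n scale V \<rho> x p =
     (\<Sum>b<n. \<Sum>i=1..n. \<Sum>j=1..n. poly_scale (x b $$ (i - 1, j - 1))
        (map_poly (factor_action n scale V b (\<rho> b (matrix_unit n i j))) p))"

text \<open>\<open>V_eps\<close> and \<open>V_limit\<close> are \<open>V\<^sub>\<lambda>(\<epsilon>)\<close> and \<open>V\<^sub>\<lambda>(0)\<close>. In \<open>V_limit\<close>, \<open>p = \<epsilon>\<^sup>r q\<close>.\<close>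

definition V_eps ::
  "nat \<Rightarrow> (complex \<Rightarrow> 'v::ab_group_add \<Rightarrow> 'v) \<Rightarrow> (nat \<Rightarrow> 'v set) \<Rightarrow> (nat \<Rightarrow> complex mat \<Rightarrow> 'v \<Rightarrow> 'v) \<Rightarrow>
   (nat \<Rightarrow> 'v) \<Rightarrow> 'v tensor poly set" where
  "V_eps n scale V \<rho> v =
     (\<lambda>M. module.subspace poly_scale M \<and>
        (\<forall>x\<in>I1 n [:0, 1:]. \<forall>p\<in>M. poly_action n scale V \<rho> x p \<in> M))
     hull {[:pure_tensor n scale V v:]}"

definition V_limit ::
  "nat \<Rightarrow> (complex \<Rightarrow> 'v::ab_group_add \<Rightarrow> 'v) \<Rightarrow> (nat \<Rightarrow> 'v set) \<Rightarrow> (nat \<Rightarrow> complex mat \<Rightarrow> 'v \<Rightarrow> 'v) \<Rightarrow>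
   (nat \<Rightarrow> 'v) \<Rightarrow> 'v tensor set" where
  "V_limit n scale V \<rho> v =
     {coeff q 0 | q r. q \<in> tensor_polys n scale V \<and> poly_scale (monom 1 r) q \<in> V_eps n scale V \<rho> v}"

section \<open>Basic properties of the encodings\<close>

lemma vector_space_tensor_scale: "vector_space tensor_scale"
  by unfold_locales (auto simp: tensor_scale_def algebra_simps fun_eq_iff)

lemma tensor_scale_zero [simp]: "tensor_scale c 0 = 0"
  by (simp add: tensor_scale_def fun_eq_iff)

lemma multilinear_form_substitute:
  assumes "b < n" and A: "\<And>u. u \<in> V b \<Longrightarrow> A u \<in> V b"
    and A_add: "\<And>u w. u \<in> V b \<Longrightarrow> w \<in> V b \<Longrightarrow> A (u + w) = A u + A w"
    and A_scale: "\<And>c u. u \<in> V b \<Longrightarrow> A (scale c u) = scale c (A u)"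
    and V: "\<And>b. b < n \<Longrightarrow> module.subspace scale (V b)" and mod: "Modules.module scale"
    and m: "multilinear_form n scale V m"
  shows "multilinear_form n scale V (\<lambda>v. if v \<in> Pi\<^sub>E {..<n} V then m (v(b := A (v b))) else 0)"
proof -
  have upd: "v(c := u) \<in> Pi\<^sub>E {..<n} V" if "v \<in> Pi\<^sub>E {..<n} V" "c < n" "u \<in> V c" for v c u
    using that by (auto simp: PiE_iff extensional_def)
  have V_add: "u + w \<in> V c" if "c < n" "u \<in> V c" "w \<in> V c" for c u w
    using Modules.module.subspace_add[OF mod V] that by blast
  have V_scale: "scale a u \<in> V c" if "c < n" "u \<in> V c" for c a u
    using Modules.module.subspace_scale[OF mod V] that by blast
  have m_add: "m (v(c := u + w)) = m (v(c := u)) + m (v(c := w))"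
    if "v \<in> Pi\<^sub>E {..<n} V" "c < n" "u \<in> V c" "w \<in> V c" for v c u w
    using m that unfolding multilinear_form_def by blast
  have m_scale: "m (v(c := scale a u)) = a * m (v(c := u))"
    if "v \<in> Pi\<^sub>E {..<n} V" "c < n" "u \<in> V c" for v c a u
    using m that unfolding multilinear_form_def by blast
  have vb: "A (v b) \<in> V b" if "v \<in> Pi\<^sub>E {..<n} V" for v
    using that \<open>b < n\<close> A by (auto simp: PiE_iff)
  have "(if v(c := u + w) \<in> Pi\<^sub>E {..<n} V then m ((v(c := u + w))(b := A ((v(c := u + w)) b))) else 0) =
      (if v(c := u) \<in> Pi\<^sub>E {..<n} V then m ((v(c := u))(b := A ((v(c := u)) b))) else 0) +
      (if v(c := w) \<in> Pi\<^sub>E {..<n} V then m ((v(c := w))(b := A ((v(c := w)) b))) else 0)"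
    if "v \<in> Pi\<^sub>E {..<n} V" "c < n" "u \<in> V c" "w \<in> V c" for v c u w
  proof (cases "c = b")
    case True
    then show ?thesis using that by (simp add: upd V_add A_add m_add A)
  next
    case False
    then show ?thesis using that m_add[of "v(b := A (v b))" c u w]
      by (simp add: upd V_add vb \<open>b < n\<close> fun_upd_twist[of b c])
  qed
  moreover have "(if v(c := scale a u) \<in> Pi\<^sub>E {..<n} V
        then m ((v(c := scale a u))(b := A ((v(c := scale a u)) b))) else 0) =
      a * (if v(c := u) \<in> Pi\<^sub>E {..<n} V then m ((v(c := u))(b := A ((v(c := u)) b))) else 0)"
    if "v \<in> Pi\<^sub>E {..<n} V" "c < n" "u \<in> V c" for v c a u
  proof (cases "c = b")
    case True
    then show ?thesis using that by (simp add: upd V_scale A_scale m_scale A)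
  next
    case False
    then show ?thesis using that m_scale[of "v(b := A (v b))" c u a]
      by (simp add: upd V_scale vb \<open>b < n\<close> fun_upd_twist[of b c])
  qed
  ultimately show ?thesis unfolding multilinear_form_def by simp
qed

lemma factor_action_pure_tensor:
  assumes v: "v \<in> Pi\<^sub>E {..<n} V" and "b < n" and A: "\<And>u. u \<in> V b \<Longrightarrow> A u \<in> V b"
    and A_add: "\<And>u w. u \<in> V b \<Longrightarrow> w \<in> V b \<Longrightarrow> A (u + w) = A u + A w"
    and A_scale: "\<And>c u. u \<in> V b \<Longrightarrow> A (scale c u) = scale c (A u)"
    and V: "\<And>b. b < n \<Longrightarrow> module.subspace scale (V b)" and mod: "Modules.module scale"
  shows "factor_action n scale V b A (pure_tensor n scale V v) =
    pure_tensor n scale V (v(b := A (v b)))"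
proof -
  have "restrict v {..<n} = v"
    using v by (metis PiE_restrict)
  moreover have "restrict (v(b := A (v b))) {..<n} = v(b := A (v b))"
    using v \<open>b < n\<close> by (intro ext) (auto simp: PiE_iff extensional_def)
  ultimately show ?thesis
    using v multilinear_form_substitute[where A = A and b = b and V = V and scale = scale, OF \<open>b < n\<close> A A_add A_scale V mod]
    unfolding factor_action_def pure_tensor_def by (intro ext) (simp del: restrict_apply)
qed

lemma map_poly_tensor_scale_0 [simp]: "map_poly (tensor_scale 0) p = 0"
  by (simp add: poly_eq_iff coeff_map_poly tensor_scale_def zero_fun_def)

lemma poly_scale_0 [simp]: "poly_scale 0 p = 0"
  by (simp add: poly_scale_def)

lemma poly_scale_pCons:
  "poly_scale (pCons a f) p = map_poly (tensor_scale a) p + pCons 0 (poly_scale f p)"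
proof (cases "f = 0 \<and> a = 0")
  case True
  then show ?thesis by simp
next
  case False
  then show ?thesis by (cases "f = 0") (auto simp: poly_scale_def)
qed

lemma coeff_poly_scale:
  "coeff (poly_scale f p) k = (\<Sum>i\<le>k. tensor_scale (coeff f i) (coeff p (k - i)))"
proof (induction f arbitrary: k)
  case 0
  then show ?case by (simp add: tensor_scale_def zero_fun_def[symmetric])
next
  case (pCons a f)
  then show ?case
    by (cases k) (auto simp: poly_scale_pCons coeff_map_poly sum.atMost_Suc_shift simp del: sum.atMost_Suc)
qed

lemma module_poly_scale: "Modules.module poly_scale"
proof
  interpret T: vector_space tensor_scale by (rule vector_space_tensor_scale)
  fix f g p q
  show "poly_scale f (p + q) = poly_scale f p + poly_scale f q"
    by (simp add: poly_eq_iff coeff_poly_scale T.scale_right_distrib sum.distrib)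
  show *: "poly_scale (f + g) p = poly_scale f p + poly_scale g p" for f g
    by (simp add: poly_eq_iff coeff_poly_scale T.scale_left_distrib sum.distrib)
  show "poly_scale 1 p = p"
    by (auto simp: poly_eq_iff one_pCons poly_scale_pCons coeff_map_poly)
  have smult: "poly_scale (Polynomial.smult a g) p = map_poly (tensor_scale a) (poly_scale g p)" for a g
    by (simp add: poly_eq_iff coeff_poly_scale coeff_map_poly T.scale_sum_right)
  have shift: "poly_scale (pCons 0 g) p = pCons 0 (poly_scale g p)" for g
    by (auto simp: poly_scale_pCons poly_eq_iff coeff_map_poly)
  show "poly_scale f (poly_scale g p) = poly_scale (f * g) p"
    by (induction f) (auto simp: poly_scale_pCons mult_pCons_left * smult shift)
qed

end

theory Submission
  imports Defs
begin

text \<open>If \<open>\<epsilon>\<^sup>r q\<close> lies in \<open>V\<^sub>\<lambda>(\<epsilon>)\<close> and \<open>x(\<epsilon>)\<close> is a generator of \<open>\<II>\<^sub>1(\<epsilon>)\<close>, then so does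
  \<open>x(\<epsilon>) \<epsilon>\<^sup>r q = \<epsilon>\<^sup>r x(\<epsilon>) q\<close>, and the value of \<open>x(\<epsilon>) q\<close> at \<open>\<epsilon> = 0\<close> is \<open>x(0)\<close> applied to \<open>q(0)\<close>. That
  \<open>\<II>\<^sub>1(\<epsilon>)\<close> is a Lie algebra, also at \<open>\<epsilon> = 0\<close>, holds because the generators \<open>x\<^sub>p\<^sub>q\<close> satisfy
  \<open>x\<^sub>p\<^sub>q x\<^sub>q\<^sub>s = \<epsilon>\<^sup>c x\<^sub>p\<^sub>s\<close> with an exponent \<open>c \<ge> 0\<close> that is the same in all components.\<close>

section \<open>The algebra \<open>\<II>\<^sub>1\<close> is closed under multiplication\<close>

text \<open>The exponent of \<open>\<epsilon>\<close> at \<open>E_{p,q}\<close> in component \<open>b\<close>. Up to the coboundary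
  \<open>[p \<le> b] - [q \<le> b]\<close> it does not depend on \<open>b\<close>; the subtraction never truncates.\<close>

definition I1_degree :: "nat \<Rightarrow> nat \<Rightarrow> nat \<Rightarrow> nat" where
  "I1_degree b p q = (of_bool (p \<le> b) + of_bool (q < p)) - of_bool (q \<le> b)"

text \<open>All three families of spanning tuples in one formula. At \<open>e = 0\<close> the
  convention \<open>0 ^ 0 = 1\<close> keeps exactly the components whose exponent is 0.\<close>

definition I1_unit :: "nat \<Rightarrow> 'a::comm_ring_1 \<Rightarrow> nat \<Rightarrow> nat \<Rightarrow> (nat \<Rightarrow> 'a mat)" where
  "I1_unit n e p q = (\<lambda>b\<in>{..<n}. e ^ I1_degree b p q \<cdot>\<^sub>m matrix_unit n p q)"

text \<open>The associative product behind \<open>tuple_bracket\<close>. It is easier to control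
  than the bracket because a product of two matrix units is a single matrix unit or zero.\<close>

definition tuple_mult :: "nat \<Rightarrow> (nat \<Rightarrow> 'a::semiring_0 mat) \<Rightarrow> (nat \<Rightarrow> 'a mat) \<Rightarrow> (nat \<Rightarrow> 'a mat)" where
  "tuple_mult n x y = (\<lambda>b\<in>{..<n}. x b * y b)"

text \<open>The coboundary in \<open>b\<close> telescopes along \<open>p\<close>, \<open>q\<close>,
  \<open>s\<close>, which leaves a constant without \<open>b\<close>. That constant does not
  truncate either: \<open>s < p\<close> forces \<open>q < p\<close> or \<open>s < q\<close>.\<close>

lemma I1_degree_add:
  "I1_degree b p q + I1_degree b q s =
    (of_bool (q < p) + of_bool (s < q) - of_bool (s < p)) + I1_degree b p s"
  by (auto simp: I1_degree_def of_bool_def)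

section \<open>Matrix units and the spanning tuples\<close>

lemma matrix_unit_carrier [simp]: "matrix_unit n p q \<in> carrier_mat n n"
  by (simp add: matrix_unit_def)

text \<open>The inner index must be in range: for \<open>q = r\<close> outside \<open>{1..n}\<close>
  both factors vanish, whereas \<open>matrix_unit n p s\<close> may be nonzero.\<close>

lemma matrix_unit_mult:
  fixes n :: nat
  assumes "q \<in> {1..n}"
  shows "(matrix_unit n p q * matrix_unit n r s :: 'a::semiring_1 mat) =
    (if q = r then matrix_unit n p s else 0\<^sub>m n n)"
proof (rule eq_matI)
  fix k l
  assume "k < dim_row (if q = r then matrix_unit n p s else 0\<^sub>m n n :: 'a mat)"
    and "l < dim_col (if q = r then matrix_unit n p s else 0\<^sub>m n n :: 'a mat)"
  then have kl: "k < n" "l < n" by (auto simp: matrix_unit_def split: if_splits)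
  have "(matrix_unit n p q * matrix_unit n r s :: 'a mat) $$ (k, l) =
      (\<Sum>i<n. (if Suc k = p \<and> Suc i = q then 1 else 0) * (if Suc i = r \<and> Suc l = s then 1 else 0))"
    using kl by (simp add: matrix_unit_def scalar_prod_def lessThan_atLeast0)
  \<comment> \<open>The index \<open>i\<close> counts from 0 and \<open>q\<close> from 1, so only
    the summand \<open>i = q - 1\<close> can survive.\<close>
  also have "\<dots> = (\<Sum>i<n. if i = q - 1 then of_bool (Suc k = p \<and> q = r \<and> Suc l = s) else 0)"
    using assms by (intro sum.cong) auto
  also have "\<dots> = (if q = r then matrix_unit n p s else 0\<^sub>m n n :: 'a mat) $$ (k, l)"
    using assms kl by (auto simp: matrix_unit_def)
  finally show "(matrix_unit n p q * matrix_unit n r s :: 'a mat) $$ (k, l) =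
    (if q = r then matrix_unit n p s else 0\<^sub>m n n :: 'a mat) $$ (k, l)" .
qed (auto simp: matrix_unit_def)

lemma commutator_carrier:
  "x \<in> carrier_mat n n \<Longrightarrow> y \<in> carrier_mat n n \<Longrightarrow> commutator x y \<in> carrier_mat n n"
  unfolding commutator_def by (intro minus_carrier_mat mult_carrier_mat)

lemma one_smult_mat [simp]: "(1 :: 'a::monoid_mult) \<cdot>\<^sub>m A = A"
  by (rule eq_matI) auto

lemma smult_smult_mat: "a \<cdot>\<^sub>m (b \<cdot>\<^sub>m A) = (a * b :: 'a::semigroup_mult) \<cdot>\<^sub>m A"
  by (rule eq_matI) (auto simp: mult.assoc)

text \<open>The exponent is 0 for \<open>p = q\<close>. For \<open>p < q\<close> it is 1 exactly if
  \<open>p \<le> b < q\<close>, and for \<open>q < p\<close> it is 0 exactly if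
  \<open>q \<le> b < p\<close>; these are the case distinctions of the definition.\<close>

lemma I1_generators_eq: "I1_generators n e = {I1_unit n e p q | p q. p \<in> {1..n} \<and> q \<in> {1..n}}"
proof -
  have diag: "(\<lambda>b\<in>{..<n}. matrix_unit n i i) = I1_unit n e i i" for i
    by (auto simp: I1_unit_def I1_degree_def restrict_def)
  have upper: "(\<lambda>b\<in>{..<n}. if i \<le> b \<and> b < j then e \<cdot>\<^sub>m matrix_unit n i j else matrix_unit n i j) =
      I1_unit n e i j" if "i < j" for i j
    using that by (auto simp: I1_unit_def I1_degree_def restrict_def fun_eq_iff)
  have lower: "(\<lambda>b\<in>{..<n}. if i \<le> b \<and> b < j then matrix_unit n j i else e \<cdot>\<^sub>m matrix_unit n j i) =
      I1_unit n e j i" if "i < j" for i j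
    using that by (auto simp: I1_unit_def I1_degree_def restrict_def fun_eq_iff)
  have "I1_generators n e = {I1_unit n e i i | i. 1 \<le> i \<and> i \<le> n} \<union>
      {I1_unit n e i j | i j. 1 \<le> i \<and> i < j \<and> j \<le> n} \<union>
      {I1_unit n e j i | i j. 1 \<le> i \<and> i < j \<and> j \<le> n}"
    unfolding I1_generators_def diag
    by (intro arg_cong2[where f = "(\<union>)"] refl Collect_cong ex_cong1) (use upper lower in metis)+
  also have "\<dots> = {I1_unit n e p q | p q. p \<in> {1..n} \<and> q \<in> {1..n}}"
  proof (intro equalityI subsetI)
    fix x assume "x \<in> {I1_unit n e p q | p q. p \<in> {1..n} \<and> q \<in> {1..n}}"
    then obtain p q where "x = I1_unit n e p q" "p \<in> {1..n}" "q \<in> {1..n}" by blast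
    then show "x \<in> {I1_unit n e i i | i. 1 \<le> i \<and> i \<le> n} \<union>
      {I1_unit n e i j | i j. 1 \<le> i \<and> i < j \<and> j \<le> n} \<union>
      {I1_unit n e j i | i j. 1 \<le> i \<and> i < j \<and> j \<le> n}"
      by (cases p q rule: linorder_cases) auto
  qed fastforce
  finally show ?thesis .
qed

lemma I1_carrier: "x \<in> I1 n e \<Longrightarrow> b < n \<Longrightarrow> x b \<in> carrier_mat n n"
  by (induction rule: I1.induct)
    (auto simp: I1_generators_eq I1_unit_def tuple_add_def tuple_smult_def)

text \<open>By \<open>I1_degree_add\<close> the surplus power of \<open>e\<close> is the same in
  every component. Hence a nonzero product of units is a scalar multiple of one generator, and not
  just a tuple with unrelated scalars in its components.\<close>

lemma tuple_mult_I1_unit: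
  assumes "q \<in> {1..n}"
  shows "tuple_mult n (I1_unit n e p q) (I1_unit n e r s) =
    (if q = r then tuple_smult n (e ^ (of_bool (q < p) + of_bool (s < q) - of_bool (s < p))) (I1_unit n e p s)
     else (\<lambda>b\<in>{..<n}. 0\<^sub>m n n))"
proof -
  have "(e ^ I1_degree b p q \<cdot>\<^sub>m matrix_unit n p q) * (e ^ I1_degree b r s \<cdot>\<^sub>m matrix_unit n r s) =
      (if q = r then e ^ (of_bool (q < p) + of_bool (s < q) - of_bool (s < p)) \<cdot>\<^sub>m
        (e ^ I1_degree b p s \<cdot>\<^sub>m matrix_unit n p s) else 0\<^sub>m n n)" for b
  proof -
    have "(e ^ I1_degree b p q \<cdot>\<^sub>m matrix_unit n p q) * (e ^ I1_degree b r s \<cdot>\<^sub>m matrix_unit n r s) =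
        e ^ I1_degree b p q \<cdot>\<^sub>m (e ^ I1_degree b r s \<cdot>\<^sub>m (matrix_unit n p q * matrix_unit n r s))"
      by (simp add: mult_smult_assoc_mat[of _ n n _ n] mult_smult_distrib[of _ n n _ n]
          smult_smult_mat mult.commute)
    also have "\<dots> = e ^ (I1_degree b p q + I1_degree b r s) \<cdot>\<^sub>m (matrix_unit n p q * matrix_unit n r s)"
      by (simp add: smult_smult_mat power_add)
    also have "\<dots> = (if q = r then e ^ (of_bool (q < p) + of_bool (s < q) - of_bool (s < p)) \<cdot>\<^sub>m
        (e ^ I1_degree b p s \<cdot>\<^sub>m matrix_unit n p s) else 0\<^sub>m n n)"
      using assms by (cases "q = r") (simp_all add: matrix_unit_mult I1_degree_add smult_smult_mat power_add)
    finally show ?thesis .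
  qed
  then show ?thesis by (auto simp: tuple_mult_def I1_unit_def tuple_smult_def restrict_def fun_eq_iff)
qed

text \<open>Bilinearity reduces products to pairs of generators. The right factor is treated here,
  the left one in \<open>tuple_mult_I1\<close>.\<close>

lemma tuple_mult_I1_generator:
  assumes x: "x \<in> I1_generators n e" and y: "y \<in> I1 n e"
  shows "tuple_mult n x y \<in> I1 n e"
  using y
proof (induction rule: I1.induct)
  case zero
  have "tuple_mult n x (\<lambda>b\<in>{..<n}. 0\<^sub>m n n) = (\<lambda>b\<in>{..<n}. 0\<^sub>m n n)"
    using I1_carrier[OF I1.generator[OF x]]
    by (auto simp: tuple_mult_def restrict_def fun_eq_iff intro!: right_mult_zero_mat)
  then show ?case by (simp only: I1.zero)
next
  case (generator y)
  obtain p q r s where pq: "p \<in> {1..n}" "q \<in> {1..n}" "r \<in> {1..n}" "s \<in> {1..n}"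
    and xy: "x = I1_unit n e p q" "y = I1_unit n e r s"
    using x generator unfolding I1_generators_eq by blast
  have "I1_unit n e p s \<in> I1 n e"
    by (rule I1.generator) (use pq in \<open>auto simp: I1_generators_eq\<close>)
  then show ?case using pq by (simp add: xy tuple_mult_I1_unit I1.smult I1.zero)
next
  case (add y z)
  have "tuple_mult n x (tuple_add n y z) = tuple_add n (tuple_mult n x y) (tuple_mult n x z)"
    using I1_carrier[OF I1.generator[OF x]] I1_carrier[OF add(1)] I1_carrier[OF add(2)]
    by (auto simp: tuple_mult_def tuple_add_def restrict_def fun_eq_iff mult_add_distrib_mat[of _ n n _ n])
  then show ?case using add by (simp add: I1.add)
next
  case (smult y c)
  have "tuple_mult n x (tuple_smult n c y) = tuple_smult n c (tuple_mult n x y)"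
    using I1_carrier[OF I1.generator[OF x]] I1_carrier[OF smult(1)]
    by (auto simp: tuple_mult_def tuple_smult_def restrict_def fun_eq_iff mult_smult_distrib[of _ n n _ n])
  then show ?case using smult by (simp add: I1.smult)
qed

lemma tuple_mult_I1:
  assumes x: "x \<in> I1 n e" and y: "y \<in> I1 n e"
  shows "tuple_mult n x y \<in> I1 n e"
  using x
proof (induction rule: I1.induct)
  case zero
  have "tuple_mult n (\<lambda>b\<in>{..<n}. 0\<^sub>m n n) y = (\<lambda>b\<in>{..<n}. 0\<^sub>m n n)"
    using I1_carrier[OF y]
    by (auto simp: tuple_mult_def restrict_def fun_eq_iff intro!: left_mult_zero_mat)
  then show ?case by (simp only: I1.zero)
next
  case (generator x)
  then show ?case using y by (rule tuple_mult_I1_generator)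
next
  case (add x z)
  have "tuple_mult n (tuple_add n x z) y = tuple_add n (tuple_mult n x y) (tuple_mult n z y)"
    using I1_carrier[OF y] I1_carrier[OF add(1)] I1_carrier[OF add(2)]
    by (auto simp: tuple_mult_def tuple_add_def restrict_def fun_eq_iff add_mult_distrib_mat[of _ n n _ _ n])
  then show ?case using add by (simp add: I1.add)
next
  case (smult x c)
  have "tuple_mult n (tuple_smult n c x) y = tuple_smult n c (tuple_mult n x y)"
    using I1_carrier[OF y] I1_carrier[OF smult(1)]
    by (auto simp: tuple_mult_def tuple_smult_def restrict_def fun_eq_iff mult_smult_assoc_mat[of _ n n _ n])
  then show ?case using smult by (simp add: I1.smult)
qed

text \<open>The span has no rule for differences, so the bracket is rewritten as
  \<open>x y + (- 1) y x\<close> for the product \<open>tuple_mult\<close>.\<close>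

lemma tuple_bracket_I1:
  assumes "x \<in> I1 n e" and "y \<in> I1 n e"
  shows "tuple_bracket n x y \<in> I1 n e"
proof -
  have "tuple_bracket n x y =
      tuple_add n (tuple_mult n x y) (tuple_smult n (- 1) (tuple_mult n y x))"
  proof
    fix b
    show "tuple_bracket n x y b =
      tuple_add n (tuple_mult n x y) (tuple_smult n (- 1) (tuple_mult n y x)) b"
    proof (cases "b < n")
      case True
      have "x b \<in> carrier_mat n n" "y b \<in> carrier_mat n n"
        using I1_carrier[OF assms(1) True] I1_carrier[OF assms(2) True] by auto
      then have "x b * y b - y b * x b = x b * y b + (- 1) \<cdot>\<^sub>m (y b * x b)"
        by (intro eq_matI) (auto simp: minus_mat_def)
      with True show ?thesis
        by (simp add: tuple_bracket_def tuple_add_def tuple_mult_def tuple_smult_def commutator_def)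
    \<comment> \<open>For \<open>b \<ge> n\<close> both sides are \<open>undefined\<close>, since
      the tuples are extensional.\<close>
    qed (simp add: tuple_bracket_def tuple_add_def)
  qed
  then show ?thesis using assms by (simp add: I1.add I1.smult tuple_mult_I1)
qed

section \<open>Tensor products of \<open>gl_n\<close>-modules\<close>

global_interpretation tensor: vector_space tensor_scale
  by (rule vector_space_tensor_scale)

global_interpretation tensor_pair: vector_space_pair tensor_scale tensor_scale
  by unfold_locales

text \<open>The operator is a transpose: it evaluates \<open>t\<close> at a modified form. This is
  linear in \<open>t\<close> for every function \<open>A\<close>.\<close>

lemma linear_factor_action:
  "Vector_Spaces.linear tensor_scale tensor_scale (factor_action n scale V b A)"
  by unfold_locales (auto simp: factor_action_def tensor_scale_def fun_eq_iff)

lemma linear_factor_action_comp: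
  "Vector_Spaces.linear tensor_scale tensor_scale
    (\<lambda>t. factor_action n scale V b A (factor_action n scale V c B t))"
  using Vector_Spaces.linear_compose[OF linear_factor_action linear_factor_action]
  by (simp only: comp_def)

lemma linear_tensor_action:
  "Vector_Spaces.linear tensor_scale tensor_scale (tensor_action n scale V \<rho> x)"
  unfolding tensor_action_def
  by (intro tensor_pair.linear_compose_sum ballI linear_factor_action)

lemma pure_tensor_add:
  assumes "v \<in> Pi\<^sub>E {..<n} V" "b < n" "u \<in> V b" "w \<in> V b"
  shows "pure_tensor n scale V (v(b := u + w)) =
    pure_tensor n scale V (v(b := u)) + pure_tensor n scale V (v(b := w))"
proof -
  have "restrict (v(b := z)) {..<n} = v(b := z)" for z
    using assms by (intro ext) (auto simp: PiE_iff extensional_def)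
  then show ?thesis
    using assms by (intro ext) (auto simp add: pure_tensor_def plus_fun_def multilinear_form_def
        simp del: restrict_apply fun_upd_apply)
qed

lemma pure_tensor_scale:
  assumes "v \<in> Pi\<^sub>E {..<n} V" "b < n" "u \<in> V b"
  shows "pure_tensor n scale V (v(b := scale c u)) =
    tensor_scale c (pure_tensor n scale V (v(b := u)))"
proof -
  have "restrict (v(b := z)) {..<n} = v(b := z)" for z
    using assms by (intro ext) (auto simp: PiE_iff extensional_def)
  then show ?thesis
    using assms by (intro ext) (auto simp add: pure_tensor_def tensor_scale_def multilinear_form_def
        simp del: restrict_apply fun_upd_apply)
qed

lemma subspace_tensor_product: "tensor.subspace (tensor_product n scale V)"
  by (simp add: tensor_product_def)

text \<open>The identities of an action are universally quantified and pass to subsets, so only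
  closure conditions have to be verified.\<close>

lemma lie_action_subalgebra:
  assumes "lie_action L plus\<^sub>L scale\<^sub>L br scale V act"
    and "L' \<subseteq> L" "V' \<subseteq> V" "module.subspace scale V'"
    and "\<And>x y. x \<in> L' \<Longrightarrow> y \<in> L' \<Longrightarrow> plus\<^sub>L x y \<in> L'" "\<And>x y. x \<in> L' \<Longrightarrow> y \<in> L' \<Longrightarrow> br x y \<in> L'"
    and "\<And>c x. x \<in> L' \<Longrightarrow> scale\<^sub>L c x \<in> L'" "\<And>x v. x \<in> L' \<Longrightarrow> v \<in> V' \<Longrightarrow> act x v \<in> V'"
  shows "lie_action L' plus\<^sub>L scale\<^sub>L br scale V' act"
  using assms(1) unfolding lie_action_def
  by (simp add: assms(4-) subsetD[OF assms(2)] subsetD[OF assms(3)])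

locale gl_modules =
  fixes n :: nat and scale :: "complex \<Rightarrow> 'v::ab_group_add \<Rightarrow> 'v"
    and V :: "nat \<Rightarrow> 'v set" and \<rho> :: "nat \<Rightarrow> complex mat \<Rightarrow> 'v \<Rightarrow> 'v"
  assumes module: "Modules.module scale"
    and gl: "b < n \<Longrightarrow> gl_module n scale (V b) (\<rho> b)"
begin

abbreviation "pure \<equiv> pure_tensor n scale V"
abbreviation "TV \<equiv> tensor_product n scale V"
abbreviation "F b x \<equiv> factor_action n scale V b (\<rho> b x)"

lemma subspace: "b < n \<Longrightarrow> module.subspace scale (V b)"
  using gl unfolding gl_module_def lie_action_def by blast

lemma
  assumes "b < n" and "x \<in> carrier_mat n n"
  shows \<rho>_closed: "u \<in> V b \<Longrightarrow> \<rho> b x u \<in> V b"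
    and \<rho>_add_right: "u \<in> V b \<Longrightarrow> w \<in> V b \<Longrightarrow> \<rho> b x (u + w) = \<rho> b x u + \<rho> b x w"
    and \<rho>_scale_right: "u \<in> V b \<Longrightarrow> \<rho> b x (scale c u) = scale c (\<rho> b x u)"
    and \<rho>_add: "y \<in> carrier_mat n n \<Longrightarrow> u \<in> V b \<Longrightarrow> \<rho> b (x + y) u = \<rho> b x u + \<rho> b y u"
    and \<rho>_scale: "u \<in> V b \<Longrightarrow> \<rho> b (c \<cdot>\<^sub>m x) u = scale c (\<rho> b x u)"
    and \<rho>_commutator: "y \<in> carrier_mat n n \<Longrightarrow> u \<in> V b \<Longrightarrow>
      \<rho> b (commutator x y) u = \<rho> b x (\<rho> b y u) - \<rho> b y (\<rho> b x u)"
  using gl[OF assms(1)] assms(2) unfolding gl_module_def lie_action_def by blast+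

lemma upd_mem: "v \<in> Pi\<^sub>E {..<n} V \<Longrightarrow> b < n \<Longrightarrow> u \<in> V b \<Longrightarrow> v(b := u) \<in> Pi\<^sub>E {..<n} V"
  by (auto simp: PiE_iff extensional_def)

lemma factor_pure:
  assumes "v \<in> Pi\<^sub>E {..<n} V" "b < n" "x \<in> carrier_mat n n"
  shows "F b x (pure v) = pure (v(b := \<rho> b x (v b)))"
  using assms by (intro factor_action_pure_tensor)
    (auto simp: \<rho>_closed \<rho>_add_right \<rho>_scale_right subspace module)

text \<open>Pure tensors span \<open>TV\<close>. This reduces each operator identity below to a
  computation with pure tensors.\<close>

lemma linear_eq_on_TV:
  assumes "Vector_Spaces.linear tensor_scale tensor_scale f"
    and "Vector_Spaces.linear tensor_scale tensor_scale g"
    and "\<And>v. v \<in> Pi\<^sub>E {..<n} V \<Longrightarrow> f (pure v) = g (pure v)" and "t \<in> TV"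
  shows "f t = g t"
  using assms(4) unfolding tensor_product_def
  by (rule tensor_pair.linear_eq_on_span[OF assms(1,2), rotated]) (use assms(3) in auto)

lemma factor_closed:
  assumes "b < n" "x \<in> carrier_mat n n" "t \<in> TV"
  shows "F b x t \<in> TV"
  using assms(3) unfolding tensor_product_def
proof (induction rule: tensor.span_induct_alt)
  case base
  show ?case
    by (simp only: tensor_pair.linear_0[OF linear_factor_action] tensor.span_zero)
next
  case (step c y z)
  then obtain v where v: "v \<in> Pi\<^sub>E {..<n} V" "y = pure v" by blast
  have "F b x y = pure (v(b := \<rho> b x (v b)))"
    using v factor_pure assms by simp
  moreover have "v(b := \<rho> b x (v b)) \<in> Pi\<^sub>E {..<n} V"
    using v assms by (intro upd_mem \<rho>_closed) (auto simp: PiE_iff)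
  ultimately have "F b x y \<in> tensor.span (pure ` Pi\<^sub>E {..<n} V)"
    by (simp add: tensor.span_base)
  then show ?case using step
    by (simp only: tensor_pair.linear_add[OF linear_factor_action]
        tensor_pair.linear_scale[OF linear_factor_action] tensor.span_add tensor.span_scale)
qed

text \<open>Membership in \<open>TV\<close> matters: an arbitrary function \<open>t\<close> of forms
  need not be additive, so its values at the forms modified by \<open>x\<close>, \<open>y\<close>
  and \<open>x + y\<close> need not be related.\<close>

lemma factor_add:
  assumes "b < n" "x \<in> carrier_mat n n" "y \<in> carrier_mat n n" "t \<in> TV"
  shows "F b (x + y) t = F b x t + F b y t"
proof (rule linear_eq_on_TV[OF _ _ _ assms(4)])
  fix v assume v: "v \<in> Pi\<^sub>E {..<n} V"
  with assms(1) have "v b \<in> V b" by auto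
  then show "F b (x + y) (pure v) = F b x (pure v) + F b y (pure v)"
    using v assms by (simp add: factor_pure \<rho>_add \<rho>_closed pure_tensor_add)
qed (intro tensor_pair.linear_compose_add linear_factor_action)+

lemma factor_scale:
  assumes "b < n" "x \<in> carrier_mat n n" "t \<in> TV"
  shows "F b (c \<cdot>\<^sub>m x) t = tensor_scale c (F b x t)"
proof (rule linear_eq_on_TV[OF _ _ _ assms(3)])
  fix v assume v: "v \<in> Pi\<^sub>E {..<n} V"
  with assms(1) have "v b \<in> V b" by auto
  then show "F b (c \<cdot>\<^sub>m x) (pure v) = tensor_scale c (F b x (pure v))"
    using v assms by (simp add: factor_pure \<rho>_scale \<rho>_closed pure_tensor_scale)
qed (intro tensor_pair.linear_compose_scale_right linear_factor_action)+

lemma factor_commutator: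
  assumes "b < n" "x \<in> carrier_mat n n" "y \<in> carrier_mat n n" "t \<in> TV"
  shows "F b (commutator x y) t = F b x (F b y t) - F b y (F b x t)"
proof (rule linear_eq_on_TV[OF _ _ _ assms(4)])
  fix v assume v: "v \<in> Pi\<^sub>E {..<n} V"
  with assms(1) have vb: "v b \<in> V b" by auto
  have c: "commutator x y \<in> carrier_mat n n" using assms by (intro commutator_carrier)
  \<comment> \<open>The commutator relation is solved for one product, because
    \<open>pure_tensor_add\<close> splits sums and not differences.\<close>
  have *: "\<rho> b x (\<rho> b y (v b)) = \<rho> b (commutator x y) (v b) + \<rho> b y (\<rho> b x (v b))"
    using vb assms by (simp add: \<rho>_commutator)
  show "F b (commutator x y) (pure v) = F b x (F b y (pure v)) - F b y (F b x (pure v))"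
    using v vb assms c by (simp add: factor_pure upd_mem \<rho>_closed * pure_tensor_add)
qed (intro tensor_pair.linear_compose_sub linear_factor_action linear_factor_action_comp)+

text \<open>On a pure tensor the two operators update different entries of \<open>v\<close>, and
  such updates commute.\<close>

lemma factor_commute:
  assumes "b < n" "c < n" "b \<noteq> c" "x \<in> carrier_mat n n" "y \<in> carrier_mat n n" "t \<in> TV"
  shows "F b x (F c y t) = F c y (F b x t)"
proof (rule linear_eq_on_TV[OF _ _ _ assms(6)])
  fix v assume v: "v \<in> Pi\<^sub>E {..<n} V"
  with assms(1,2) have "v b \<in> V b" "v c \<in> V c" by auto
  then show "F b x (F c y (pure v)) = F c y (F b x (pure v))"
    using v assms by (simp add: factor_pure upd_mem \<rho>_closed fun_upd_twist)
qed (intro linear_factor_action_comp)+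

section \<open>The direct sum of copies of \<open>gl_n\<close> acting on the tensor product\<close>

lemma tensor_action_closed:
  assumes "\<And>b. b < n \<Longrightarrow> x b \<in> carrier_mat n n" "t \<in> TV"
  shows "tensor_action n scale V \<rho> x t \<in> TV"
  unfolding tensor_action_def
  by (intro tensor.subspace_sum[OF subspace_tensor_product] factor_closed) (use assms in auto)

lemma tensor_action_bracket:
  assumes x: "\<And>b. b < n \<Longrightarrow> x b \<in> carrier_mat n n" and y: "\<And>b. b < n \<Longrightarrow> y b \<in> carrier_mat n n"
    and t: "t \<in> TV"
  defines "act \<equiv> tensor_action n scale V \<rho>"
  shows "act (tuple_bracket n x y) t = act x (act y t) - act y (act x t)"
proof -
  have xy: "act x (act y t) = (\<Sum>b<n. \<Sum>c<n. F b (x b) (F c (y c) t))"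
    by (simp add: act_def tensor_action_def tensor_pair.linear_sum[OF linear_factor_action])
  have "act y (act x t) = (\<Sum>c<n. \<Sum>b<n. F c (y c) (F b (x b) t))"
    by (simp add: act_def tensor_action_def tensor_pair.linear_sum[OF linear_factor_action])
  also have "\<dots> = (\<Sum>b<n. \<Sum>c<n. F c (y c) (F b (x b) t))"
    by (rule sum.swap)
  finally have yx: "act y (act x t) = (\<Sum>b<n. \<Sum>c<n. F c (y c) (F b (x b) t))" .
  have "act x (act y t) - act y (act x t) =
      (\<Sum>b<n. \<Sum>c<n. F b (x b) (F c (y c) t) - F c (y c) (F b (x b) t))"
    by (simp add: xy yx sum_subtractf)
  \<comment> \<open>Operators in different factors commute, so only the diagonal
    \<open>c = b\<close> of the double sum remains, where the commutator acts in a single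
    factor.\<close>
  also have "\<dots> = (\<Sum>b<n. \<Sum>c<n. if c = b then F b (commutator (x b) (y b)) t else 0)"
    by (intro sum.cong refl)
      (use x y t in \<open>auto simp: factor_commutator intro!: factor_commute\<close>)
  also have "\<dots> = act (tuple_bracket n x y) t"
    by (simp add: act_def tensor_action_def tuple_bracket_def)
  finally show ?thesis by simp
qed

text \<open>The sum over \<open>b < n\<close> reduces addition and scaling to a single factor;
  \<open>tensor_action_bracket\<close> supplies the bracket. The tuples range over a set that
  contains \<open>I1 n 0\<close>.\<close>

lemma lie_action_tensor_product:
  "lie_action ({..<n} \<rightarrow> carrier_mat n n) (tuple_add n) (tuple_smult n) (tuple_bracket n)
     tensor_scale TV (tensor_action n scale V \<rho>)"
proof -
  have 1: "tensor_action n scale V \<rho> (tuple_add n x y) t =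
      tensor_action n scale V \<rho> x t + tensor_action n scale V \<rho> y t"
    if "x \<in> {..<n} \<rightarrow> carrier_mat n n" "y \<in> {..<n} \<rightarrow> carrier_mat n n" "t \<in> TV" for x y t
    unfolding tensor_action_def sum.distrib[symmetric]
    by (intro sum.cong) (use that in \<open>auto simp: tuple_add_def Pi_iff factor_add\<close>)
  have 2: "tensor_action n scale V \<rho> (tuple_smult n c x) t =
      tensor_scale c (tensor_action n scale V \<rho> x t)"
    if "x \<in> {..<n} \<rightarrow> carrier_mat n n" "t \<in> TV" for c x t
    unfolding tensor_action_def tensor.scale_sum_right
    by (intro sum.cong) (use that in \<open>auto simp: tuple_smult_def Pi_iff factor_scale\<close>)
  have 3: "tuple_add n x y \<in> {..<n} \<rightarrow> carrier_mat n n" "tuple_bracket n x y \<in> {..<n} \<rightarrow> carrier_mat n n"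
    "tuple_smult n c x \<in> {..<n} \<rightarrow> carrier_mat n n"
    if "x \<in> {..<n} \<rightarrow> carrier_mat n n" "y \<in> {..<n} \<rightarrow> carrier_mat n n" for c x y
    using that by (auto simp: tuple_add_def tuple_bracket_def tuple_smult_def commutator_carrier Pi_iff)
  have 4: "tensor_action n scale V \<rho> x t \<in> TV"
    if "x \<in> {..<n} \<rightarrow> carrier_mat n n" "t \<in> TV" for x t
    by (rule tensor_action_closed) (use that in auto)
  have 5: "tensor_action n scale V \<rho> (tuple_bracket n x y) t =
      tensor_action n scale V \<rho> x (tensor_action n scale V \<rho> y t) -
      tensor_action n scale V \<rho> y (tensor_action n scale V \<rho> x t)"
    if "x \<in> {..<n} \<rightarrow> carrier_mat n n" "y \<in> {..<n} \<rightarrow> carrier_mat n n" "t \<in> TV" for x y t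
    by (rule tensor_action_bracket) (use that in auto)
  show ?thesis
    unfolding lie_action_def
    by (intro conjI ballI allI; (rule 1 2 3 4 5 subspace_tensor_product
        tensor_pair.linear_add[OF linear_tensor_action]
        tensor_pair.linear_scale[OF linear_tensor_action])?; assumption?)
qed

end

section \<open>The limit \<open>\<epsilon> \<rightarrow> 0\<close>\<close>

global_interpretation poly: Modules.module poly_scale
  by (rule module_poly_scale)

lemma coeff_poly_scale_0:
  "coeff (poly_scale f p) 0 = tensor_scale (coeff f 0) (coeff p 0)"
  by (simp add: coeff_poly_scale)

text \<open>Each coefficient of \<open>poly_scale f p\<close> is a complex linear combination of
  coefficients of \<open>p\<close>. Linearity also gives \<open>A 0 = 0\<close>, which makes
  \<open>map_poly\<close> act coefficientwise.\<close>

lemma map_poly_linear_poly_scale: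
  assumes "Vector_Spaces.linear tensor_scale tensor_scale A"
  shows "map_poly A (poly_scale f p) = poly_scale f (map_poly A p)"
  by (simp add: poly_eq_iff coeff_map_poly coeff_poly_scale tensor_pair.linear_0[OF assms]
      tensor_pair.linear_sum[OF assms] tensor_pair.linear_scale[OF assms])

text \<open>This allows the factor \<epsilon> to the power \<open>r\<close> to be pulled out of the
  action.\<close>

lemma poly_action_poly_scale:
  "poly_action n scale V \<rho> x (poly_scale f p) = poly_scale f (poly_action n scale V \<rho> x p)"
  by (simp add: poly_action_def map_poly_linear_poly_scale[OF linear_factor_action]
      poly.scale_sum_right mult.commute)

lemma tensor_polys_add:
  "p \<in> tensor_polys n scale V \<Longrightarrow> q \<in> tensor_polys n scale V \<Longrightarrow> p + q \<in> tensor_polys n scale V"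
  by (simp add: tensor_polys_def tensor.subspace_add[OF subspace_tensor_product])

lemma tensor_polys_poly_scale:
  "p \<in> tensor_polys n scale V \<Longrightarrow> poly_scale f p \<in> tensor_polys n scale V"
  by (auto simp: tensor_polys_def coeff_poly_scale
      intro!: tensor.subspace_sum[OF subspace_tensor_product]
        tensor.subspace_scale[OF subspace_tensor_product])

text \<open>The tuple \<open>x\<close> contributes only polynomial scalars; the operators are those
  of matrix units, and these preserve \<open>TV\<close>.\<close>

lemma (in gl_modules) tensor_polys_poly_action:
  assumes "p \<in> tensor_polys n scale V"
  shows "poly_action n scale V \<rho> x p \<in> tensor_polys n scale V"
  using assms
  by (auto simp: tensor_polys_def poly_action_def coeff_sum coeff_poly_scale coeff_map_poly
      tensor_pair.linear_0[OF linear_factor_action]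
      intro!: tensor.subspace_sum[OF subspace_tensor_product] factor_closed
        tensor.subspace_scale[OF subspace_tensor_product])

text \<open>Setting \<epsilon> to 0 is compatible with the action, because the constant term of a
  product is the product of the constant terms.\<close>

lemma (in gl_modules) coeff_poly_action_I1_unit:
  assumes p: "p \<in> tensor_polys n scale V" and ij: "i \<in> {1..n}" "j \<in> {1..n}"
  shows "coeff (poly_action n scale V \<rho> (I1_unit n [:0, 1:] i j) p) 0 =
    tensor_action n scale V \<rho> (I1_unit n 0 i j) (coeff p 0)"
proof -
  have unit: "I1_unit n [:0, 1:] i j b $$ (k - 1, l - 1) =
      (if k = i \<and> l = j then [:0, 1:] ^ I1_degree b i j else 0)"
    if "b < n" "k \<in> {1..n}" "l \<in> {1..n}" for b k l
    using that by (auto simp: I1_unit_def matrix_unit_def)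
  \<comment> \<open>For \<open>d = 0\<close> both sides are 1, in agreement with the components of
    \<open>I1_unit n 0 i j\<close> that survive.\<close>
  have c0: "coeff ([:0, 1:] ^ d :: complex poly) 0 = 0 ^ d" for d
    by (simp add: poly_0_coeff_0[symmetric])
  have p0: "coeff p 0 \<in> TV" using p by (simp add: tensor_polys_def)
  \<comment> \<open>The tuple has a single nonzero entry position, so the expansion in matrix units
    collapses to the term \<open>k = i\<close>, \<open>l = j\<close>.\<close>
  have "poly_action n scale V \<rho> (I1_unit n [:0, 1:] i j) p =
      (\<Sum>b<n. \<Sum>k=1..n. \<Sum>l=1..n. if l = j then if k = i then
        poly_scale ([:0, 1:] ^ I1_degree b i j) (map_poly (F b (matrix_unit n i j)) p) else 0 else 0)"
    unfolding poly_action_def by (intro sum.cong refl) (simp add: unit del: One_nat_def)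
  also have "\<dots> = (\<Sum>b<n. poly_scale ([:0, 1:] ^ I1_degree b i j) (map_poly (F b (matrix_unit n i j)) p))"
    using ij by simp
  finally have "coeff (poly_action n scale V \<rho> (I1_unit n [:0, 1:] i j) p) 0 =
      (\<Sum>b<n. tensor_scale (0 ^ I1_degree b i j) (F b (matrix_unit n i j) (coeff p 0)))"
    by (simp add: coeff_sum coeff_poly_scale_0 coeff_map_poly c0
        tensor_pair.linear_0[OF linear_factor_action])
  also have "\<dots> = tensor_action n scale V \<rho> (I1_unit n 0 i j) (coeff p 0)"
    using p0 by (simp add: tensor_action_def I1_unit_def factor_scale)
  finally show ?thesis .
qed

section \<open>The module \<open>V_eps\<close> and its limit \<open>V_limit\<close>\<close>

lemma subspace_V_eps: "poly.subspace (V_eps n scale V \<rho> v)"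
  unfolding V_eps_def hull_def by (rule poly.subspace_Inter) auto

text \<open>The hull is an intersection of stable submodules, and stability passes to
  intersections.\<close>

lemma poly_action_V_eps:
  "x \<in> I1 n [:0, 1:] \<Longrightarrow> p \<in> V_eps n scale V \<rho> v \<Longrightarrow> poly_action n scale V \<rho> x p \<in> V_eps n scale V \<rho> v"
  unfolding V_eps_def hull_def by blast

lemma V_limit_subset: "V_limit n scale V \<rho> v \<subseteq> tensor_product n scale V"
  by (auto simp: V_limit_def tensor_polys_def)

lemma subspace_V_limit: "tensor.subspace (V_limit n scale V \<rho> v)"
proof (rule tensor.subspaceI)
  \<comment> \<open>Zero is the limit obtained from \<open>q = 0\<close> and
    \<open>r = 0\<close>.\<close>
  have "poly_scale (monom 1 0) 0 \<in> V_eps n scale V \<rho> v" "0 \<in> tensor_polys n scale V"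
    using poly.subspace_0[OF subspace_V_eps]
    by (auto simp: tensor_polys_def tensor.subspace_0[OF subspace_tensor_product])
  then show "0 \<in> V_limit n scale V \<rho> v"
    unfolding V_limit_def by (metis (mono_tags, lifting) coeff_0 mem_Collect_eq)
next
  fix s t assume "s \<in> V_limit n scale V \<rho> v" "t \<in> V_limit n scale V \<rho> v"
  then obtain q r q' r' where q: "s = coeff q 0" "q \<in> tensor_polys n scale V"
      "poly_scale (monom 1 r) q \<in> V_eps n scale V \<rho> v"
    and q': "t = coeff q' 0" "q' \<in> tensor_polys n scale V"
      "poly_scale (monom 1 r') q' \<in> V_eps n scale V \<rho> v"
    unfolding V_limit_def by blast
  \<comment> \<open>The exponents \<open>r\<close> and \<open>r'\<close> may differ. Multiplying
    each element by the power of \<epsilon> belonging to the other gives the common exponent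
    \<open>r + r'\<close>.\<close>
  have "poly_scale (monom 1 (r + r')) (q + q') =
      poly_scale (monom 1 r') (poly_scale (monom 1 r) q) +
      poly_scale (monom 1 r) (poly_scale (monom 1 r') q')"
    by (simp add: poly.scale_right_distrib mult_monom add.commute)
  also have "\<dots> \<in> V_eps n scale V \<rho> v"
    by (rule poly.subspace_add[OF subspace_V_eps poly.subspace_scale[OF subspace_V_eps q(3)]
          poly.subspace_scale[OF subspace_V_eps q'(3)]])
  finally have "poly_scale (monom 1 (r + r')) (q + q') \<in> V_eps n scale V \<rho> v" .
  moreover have "s + t = coeff (q + q') 0" by (simp add: q q')
  ultimately show "s + t \<in> V_limit n scale V \<rho> v"
    unfolding V_limit_def using tensor_polys_add[OF q(2) q'(2)] by blast
next
  fix c t assume "t \<in> V_limit n scale V \<rho> v"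
  then obtain q r where q: "t = coeff q 0" "q \<in> tensor_polys n scale V"
      "poly_scale (monom 1 r) q \<in> V_eps n scale V \<rho> v"
    unfolding V_limit_def by blast
  have "poly_scale (monom 1 r) (poly_scale [:c:] q) \<in> V_eps n scale V \<rho> v"
    by (subst poly.scale_left_commute) (rule poly.subspace_scale[OF subspace_V_eps q(3)])
  moreover have "tensor_scale c t = coeff (poly_scale [:c:] q) 0"
    by (simp add: q coeff_poly_scale)
  ultimately show "tensor_scale c t \<in> V_limit n scale V \<rho> v"
    unfolding V_limit_def using tensor_polys_poly_scale[OF q(2)] by blast
qed

text \<open>Only generators are lifted from 0 to \<epsilon>. Sums and multiples are formed after the
  limit, inside the subspace \<open>V_limit\<close>.\<close>

lemma (in gl_modules) tensor_action_V_limit: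
  assumes "x \<in> I1 n 0" and "t \<in> V_limit n scale V \<rho> v"
  shows "tensor_action n scale V \<rho> x t \<in> V_limit n scale V \<rho> v"
proof -
  note lie = lie_action_tensor_product[unfolded lie_action_def]
  have t: "t \<in> TV" using assms(2) V_limit_subset by blast
  show ?thesis
    using assms(1)
  proof (induction rule: I1.induct)
    case zero
    \<comment> \<open>The zero matrix is 0 times itself, so \<open>factor_scale\<close> with scalar
      0 applies.\<close>
    have "F b (0\<^sub>m n n) t = 0" if "b < n" for b
      using factor_scale[OF that zero_carrier_mat t, of 0] by simp
    then have "tensor_action n scale V \<rho> (\<lambda>b\<in>{..<n}. 0\<^sub>m n n) t = 0"
      by (simp add: tensor_action_def)
    then show ?case by (simp only: tensor.subspace_0[OF subspace_V_limit])
  next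
    case (generator x)
    then obtain i j where ij: "i \<in> {1..n}" "j \<in> {1..n}" "x = I1_unit n 0 i j"
      unfolding I1_generators_eq by blast
    obtain q r where q: "t = coeff q 0" "q \<in> tensor_polys n scale V"
        "poly_scale (monom 1 r) q \<in> V_eps n scale V \<rho> v"
      using assms(2) unfolding V_limit_def by blast
    \<comment> \<open>The witness is the lifted generator applied to \<open>q\<close>, with the same
      exponent \<open>r\<close>.\<close>
    let ?q = "poly_action n scale V \<rho> (I1_unit n [:0, 1:] i j) q"
    have "I1_unit n [:0, 1:] i j \<in> I1 n [:0, 1::complex:]"
      by (rule I1.generator) (use ij in \<open>auto simp: I1_generators_eq\<close>)
    then have "poly_scale (monom 1 r) ?q \<in> V_eps n scale V \<rho> v"
      using poly_action_V_eps[OF _ q(3)] by (simp add: poly_action_poly_scale)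
    moreover have "tensor_action n scale V \<rho> x t = coeff ?q 0"
      using coeff_poly_action_I1_unit q ij by simp
    ultimately show ?case
      unfolding V_limit_def using tensor_polys_poly_action[OF q(2)] by blast
  next
    case (add x y)
    have "x \<in> {..<n} \<rightarrow> carrier_mat n n" "y \<in> {..<n} \<rightarrow> carrier_mat n n"
      using I1_carrier[OF add(1)] I1_carrier[OF add(2)] by auto
    then have "tensor_action n scale V \<rho> (tuple_add n x y) t =
        tensor_action n scale V \<rho> x t + tensor_action n scale V \<rho> y t"
      using lie t by blast
    then show ?case using add by (simp only: tensor.subspace_add[OF subspace_V_limit])
  next
    case (smult x c)
    have "x \<in> {..<n} \<rightarrow> carrier_mat n n"
      using I1_carrier[OF smult(1)] by auto
    then have "tensor_action n scale V \<rho> (tuple_smult n c x) t =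
        tensor_scale c (tensor_action n scale V \<rho> x t)"
      using lie t by blast
    then show ?case using smult by (simp only: tensor.subspace_scale[OF subspace_V_limit])
  qed
qed

theorem lemma6p12:
  fixes n :: nat
    and lam :: "nat \<Rightarrow> nat \<Rightarrow> complex"
    and scale :: "complex \<Rightarrow> 'v::ab_group_add \<Rightarrow> 'v"
    and V :: "nat \<Rightarrow> 'v set"
    and \<rho> :: "nat \<Rightarrow> complex mat \<Rightarrow> 'v \<Rightarrow> 'v"
    and v :: "nat \<Rightarrow> 'v"
  assumes "n \<ge> 2"
    and "\<And>b. b < n \<Longrightarrow> dominant_integral n (lam b)"
    and "vector_space scale"
    and "\<And>b. b < n \<Longrightarrow> irreducible_highest_weight_module n scale (V b) (\<rho> b) (lam b)"
    and "\<And>b. b < n \<Longrightarrow> lowest_weight_vector n scale (V b) (\<rho> b) (v b)"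
  shows "V_limit n scale V \<rho> v \<subseteq> tensor_product n scale V \<and>
         lie_action (I1 n 0) (tuple_add n) (tuple_smult n) (tuple_bracket n)
           tensor_scale (V_limit n scale V \<rho> v) (tensor_action n scale V \<rho>)"
proof -
  interpret gl_modules n scale V \<rho>
    using assms(3,4) by unfold_locales
      (auto simp: irreducible_highest_weight_module_def module_iff_vector_space[symmetric]
        vector_space_def Modules.module_def)
  have "lie_action (I1 n 0) (tuple_add n) (tuple_smult n) (tuple_bracket n)
      tensor_scale (V_limit n scale V \<rho> v) (tensor_action n scale V \<rho>)"
    \<comment> \<open>The Lie identities come from the action on the whole tensor product; what
      remains is closure of \<open>I1 n 0\<close> and stability of \<open>V_limit\<close>.\<close>
    by (rule lie_action_subalgebra[OF lie_action_tensor_product])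
      (auto simp: I1_carrier V_limit_subset subspace_V_limit
        I1.add I1.smult tuple_bracket_I1 tensor_action_V_limit)
  then show ?thesis using V_limit_subset by blast
qed

end
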